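(* Let $s\in(0,1)$, $f(z)=z^{s-2}$, and let $\mathbf u^{\mathrm{Dual}}_{k+1}$ be the dual reduced basis approximation with pairwise distinct snapshots $(t_j)_{j=0}^k\subset[0,\infty)\cup\{\infty\}$. Let $W\in\mathbb{R}^{n\times(k+1)}$ be a matrix whose columns form an orthonormal basis of the rational Krylov space $\mathcal Q_{k+1}(L^{-1},L^{-1}\mathbf b)$ with poles $d_j=-t_j^{-1}$, $j=0,\dots,k$, let $L_{*,k+1}=W^TL^{-1}W$, and put $$\mathbf u_{k+1}=W f(L_{*,k+1})W^TL^{-1}\mathbf b .$$ Assume $t_j=\infty$ for one $j\in\{0,\dots,k\}$, such that $d_j=-1/\infty=0$. Then $$\mathbf u^{\mathrm{Dual}}_{k+1}=L^{-1}\mathbf u_{k+1}.$$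
   Context: $L=M^{-1}K\in\mathbb{R}^{n\times n}$, where $K$ and $M$ are the symmetric positive definite stiffness and mass matrices of a finite-dimensional discretization of a self-adjoint elliptic diffusion operator with homogeneous Dirichlet conditions, and $\mathbf b\in\mathbb{R}^n$. The superscript $T$ is the ordinary transpose, and orthonormality is with respect to the Euclidean inner product. Reduced space: for $t\in[0,\infty)$ put $\mathbf w(t)=(tI+L)^{-1}\mathbf b$, and $\mathbf w(\infty):=\mathbf b$. Then $\mathcal V_{k+1}(L,\mathbf b)=\operatorname{span}\{\mathbf w(t_0),\dots,\mathbf w(t_k)\}$; the parameters $t_j$ are called snapshots. Dual reduced basis approximation: let $V\in\mathbb{R}^{n\times(k+1)}$ be a matrix whose columns form an orthonormal basis of $\mathcal V_{k+1}(L,\mathbf b)$. Then $$\mathbf u^{\mathrm{Dual}}_{k+1}=L^{-1}V\,(V^TL^{-1}V)^{s-1}\,V^T\mathbf b .$$ Rational Krylov space: for a square matrix $A$, a vector $\mathbf c$ and poles $(d_j)_{j=0}^k\subset(-\infty,0]\cup\{-\infty\}$ put $q_k(z)=\prod_{0\le j\le k,\ d_j\neq-\infty}(z-d_j)$ and $\mathcal Q_{k+1}(A,\mathbf c)=q_k(A)^{-1}\operatorname{span}\{\mathbf c,A\mathbf c,\dots,A^k\mathbf c\}$. Here $A=L^{-1}$ and $\mathbf c=L^{-1}\mathbf b$; for $t_j=0$ the pole is $d_j=-\infty$. *)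

theory Defs
  imports "HOL-Complex_Analysis.Complex_Analysis"
begin

definition spd :: "real^'n^'n \<Rightarrow> bool" where
  "spd A \<longleftrightarrow> transpose A = A \<and> (\<forall>x. x \<noteq> 0 \<longrightarrow> 0 < x \<bullet> (A *v x))"

definition orthonormal_basis_columns :: "real^'m^'n \<Rightarrow> (real^'n) set \<Rightarrow> bool" where
  "orthonormal_basis_columns V S \<longleftrightarrow>
     (\<forall>i j. column i V \<bullet> column j V = (if i = j then 1 else 0)) \<and> span (columns V) = S"

abbreviation cmat :: "real^'m^'n \<Rightarrow> complex^'m^'n" where
  "cmat \<equiv> map_matrix complex_of_real"

definition cvec :: "real^'n \<Rightarrow> complex^'n" where
  "cvec x = (\<chi> i. complex_of_real (x $ i))"


text \<open>The type class power on vectors and matrices of \<^theory>\<open>HOL-Analysis.Finite_Cartesian_Product\<close>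
  is the componentwise one, hence a separate power with respect to the matrix product.\<close>

definition mat_pow :: "'a::comm_ring_1^'n^'n \<Rightarrow> nat \<Rightarrow> 'a^'n^'n" where
  "mat_pow A i = (((**) A) ^^ i) (mat 1)"

definition mat_poly :: "'a::comm_ring_1 poly \<Rightarrow> 'a^'n^'n \<Rightarrow> 'a^'n^'n" where
  "mat_poly p A = (\<Sum>i\<le>degree p. mat (coeff p i) ** mat_pow A i)"


text \<open>Primary matrix functions. The index of \<open>c\<close> is the size of the largest Jordan block of \<open>A\<close>
  for \<open>c\<close>, i.e. the multiplicity of \<open>c\<close> as a root of the minimal polynomial; it is 0 iff \<open>c\<close> is not
  an eigenvalue. The matrix \<open>f(A)\<close> is \<open>p(A)\<close> for any polynomial \<open>p\<close> that interpolates \<open>f\<close> on the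
  spectrum of \<open>A\<close> in the sense of Hermite. As with division by zero, the value is 0 where \<open>f(A)\<close> is
  undefined, i.e. if \<open>f\<close> fails to be analytic at some eigenvalue. No diagonalizability is assumed: a
  compression of a matrix that is not symmetric may have Jordan blocks and complex eigenvalues.\<close>

definition spec_index :: "complex^'n^'n \<Rightarrow> complex \<Rightarrow> nat" where
  "spec_index A c =
     (LEAST r. \<forall>v. mat_pow (A - mat c) (Suc r) *v v = 0 \<longrightarrow> mat_pow (A - mat c) r *v v = 0)"

definition spectrum_of :: "complex^'n^'n \<Rightarrow> complex set" where
  "spectrum_of A = {c. \<exists>v. v \<noteq> 0 \<and> A *v v = c *s v}"

definition hermite_interpolates :: "complex poly \<Rightarrow> (complex \<Rightarrow> complex) \<Rightarrow> complex^'n^'n \<Rightarrow> bool" where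
  "hermite_interpolates p f A \<longleftrightarrow>
     (\<forall>c\<in>spectrum_of A. \<forall>j<spec_index A c. poly ((pderiv ^^ j) p) c = (deriv ^^ j) f c)"

definition mat_fun :: "(complex \<Rightarrow> complex) \<Rightarrow> complex^'n^'n \<Rightarrow> complex^'n^'n" where
  "mat_fun f A =
     (if f analytic_on spectrum_of A
      then THE B. \<exists>p. hermite_interpolates p f A \<and> B = mat_poly p A
      else 0)"


definition rb_snapshot :: "real^'n^'n \<Rightarrow> real^'n \<Rightarrow> ereal \<Rightarrow> real^'n" where
  "rb_snapshot L b t =
     (if t = \<infinity> then b else matrix_inv (mat (real_of_ereal t) + L) *v b)"

definition rb_space :: "real^'n^'n \<Rightarrow> real^'n \<Rightarrow> (nat \<Rightarrow> ereal) \<Rightarrow> nat \<Rightarrow> (real^'n) set" where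
  "rb_space L b t k = span ((\<lambda>j. rb_snapshot L b (t j)) ` {..k})"

definition krylov_denom :: "(nat \<Rightarrow> ereal) \<Rightarrow> nat \<Rightarrow> real poly" where
  "krylov_denom d k = (\<Prod>j\<in>{j. j \<le> k \<and> d j \<noteq> -\<infinity>}. [:- real_of_ereal (d j), 1:])"

definition rational_krylov ::
    "real^'n^'n \<Rightarrow> real^'n \<Rightarrow> (nat \<Rightarrow> ereal) \<Rightarrow> nat \<Rightarrow> (real^'n) set" where
  "rational_krylov A c d k =
     (*v) (matrix_inv (mat_poly (krylov_denom d k) A)) ` span ((\<lambda>i. mat_pow A i *v c) ` {..k})"


text \<open>The approximations are vectors over the complex numbers because the compressed matrix
  need not be symmetric for the Euclidean inner product; fractional powers are
  principal ones (\<^term>\<open>(powr)\<close> on the complex numbers), analytic off the nonpositive reals.\<close>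

definition dual_rb_approx :: "real^'n^'n \<Rightarrow> real^'n \<Rightarrow> real \<Rightarrow> real^'m^'n \<Rightarrow> complex^'n" where
  "dual_rb_approx L b s V =
     cmat (matrix_inv L) *v (cmat V *v
       (mat_fun (\<lambda>z. z powr complex_of_real (s - 1)) (cmat (transpose V ** matrix_inv L ** V))
          *v cvec (transpose V *v b)))"

definition krylov_approx ::
    "(complex \<Rightarrow> complex) \<Rightarrow> real^'n^'n \<Rightarrow> real^'n \<Rightarrow> real^'m^'n \<Rightarrow> complex^'n" where
  "krylov_approx f A c W =
     cmat W *v (mat_fun f (cmat (transpose W ** A ** W)) *v cvec (transpose W *v c))"

end

(* The snapshots are w(t) = r(L^{-1}) L^{-1} b with r(z) = (1/t) / (z + 1/t) for 0 < t < infinity, so the reduced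
   basis space S coincides with the rational Krylov space and W = V Q for an orthogonal matrix Q.
   Primary matrix functions commute with the similarity Q, so that u_{k+1} = V f(H) V^T L^{-1} b
   with H = V^T L^{-1} V. The snapshot at infinity puts b = V V^T b into S, hence
   V^T L^{-1} b = H V^T b, and f(H) H = g(H) for g(z) = z f(z) = z^{s-1}.
   As H need not be symmetric, f(H) is handled through Hermite interpolation. If the spectrum of H
   meets the set where the powers are not analytic, both f(H) and g(H) are 0 by convention;
   f and g fail to be analytic at the same points because neither is analytic at 0. *)
theory Submission
  imports Defs "HOL-Computational_Algebra.Fundamental_Theorem_Algebra"
begin

section \<open>Matrix polynomials\<close>

lemma mat_nth: "mat a $ i $ j = (if i = j then a else 0)"
  by (simp add: mat_def)

lemma mat_mul_left: "mat c ** A = (\<chi> i j. c * A $ i $ j)"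
  for A :: "'a::comm_ring_1^'m^'n"
  by (simp add: vec_eq_iff matrix_matrix_mult_def mat_nth if_distrib[where f="\<lambda>x. x * _"] cong: if_cong)

lemma mat_mul_right: "A ** mat c = (\<chi> i j. c * A $ i $ j)"
  for A :: "'a::comm_ring_1^'m^'n"
  by (simp add: vec_eq_iff matrix_matrix_mult_def mat_nth if_distrib[where f="\<lambda>x. _ * x"] mult.commute cong: if_cong)

lemma mat_commutes: "A ** mat c = mat c ** A"
  for A :: "'a::comm_ring_1^'m^'n"
  by (simp only: mat_mul_left mat_mul_right)

lemma mat_add: "mat (a + b) = mat a + (mat b :: 'a::comm_ring_1^'n^'n)"
  by (simp add: vec_eq_iff mat_nth)

lemma mat_mult: "mat (a * b) = mat a ** (mat b :: 'a::comm_ring_1^'n^'n)"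
  by (simp add: mat_mul_left vec_eq_iff mat_nth)

lemma mat_mult_vec: "mat c *v x = c *s x" for x :: "'a::comm_ring_1^'n"
  by (simp add: vec_eq_iff matrix_vector_mult_def mat_nth if_distrib[where f="\<lambda>y. y * _"] cong: if_cong)

lemma matrix_vector_mult_scale: "A *v (c *s x) = c *s (A *v x)"
  for A :: "'a::comm_ring_1^'m^'n"
  by (simp add: vec_eq_iff matrix_vector_mult_def sum_distrib_left mult_ac)

lemma matrix_add_rdistrib: "(B + C) ** A = B ** A + C ** A"
  by (vector matrix_matrix_mult_def sum.distrib[symmetric] field_simps)

lemma matrix_sum_ldistrib: "A ** (\<Sum>i\<in>I. f i) = (\<Sum>i\<in>I. A ** f i)"
  for A :: "'a::comm_ring_1^'m^'n"
  by (induction I rule: infinite_finite_induct) (simp_all add: matrix_add_ldistrib)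

lemma mat_pow_0 [simp]: "mat_pow A 0 = mat 1"
  by (simp add: mat_pow_def)

lemma mat_pow_Suc [simp]: "mat_pow A (Suc i) = A ** mat_pow A i"
  by (simp add: mat_pow_def)

text \<open>Padding with zero coefficients frees the sum from the exact degree; this matters for
  \<open>pCons a 0\<close>, whose degree is 0 and not \<open>Suc (degree 0)\<close>.\<close>

lemma mat_poly_eq_sum:
  fixes A :: "'a::comm_ring_1^'n^'n"
  assumes "degree p \<le> n"
  shows "mat_poly p A = (\<Sum>i\<le>n. mat (coeff p i) ** mat_pow A i)"
  unfolding mat_poly_def using assms
  by (intro sum.mono_neutral_left) (auto simp: coeff_eq_0)

lemma mat_poly_0 [simp]: "mat_poly 0 A = 0"
  by (simp add: mat_poly_def)

text \<open>Horner's rule, the recursion behind the polynomial inductions below.\<close>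

lemma mat_poly_pCons: "mat_poly (pCons a p) A = mat a + A ** mat_poly p A"
  for A :: "'a::comm_ring_1^'n^'n"
proof -
  have "mat_poly (pCons a p) A = (\<Sum>i\<le>Suc (degree p). mat (coeff (pCons a p) i) ** mat_pow A i)"
    by (intro mat_poly_eq_sum degree_pCons_le)
  also have "\<dots> = mat a + A ** mat_poly p A"
    by (simp only: sum.atMost_Suc_shift mat_poly_def coeff_pCons_0 coeff_pCons_Suc mat_pow_0
        mat_pow_Suc matrix_mul_rid matrix_sum_ldistrib matrix_mul_assoc mat_commutes[of A])
  finally show ?thesis .
qed

lemma mat_poly_1 [simp]: "mat_poly 1 A = mat 1" for A :: "'a::comm_ring_1^'n^'n"
  by (simp add: mat_poly_pCons one_pCons)

lemma mat_poly_linear: "mat_poly [:a, 1:] A = mat a + A" for A :: "'a::comm_ring_1^'n^'n"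
  by (simp add: mat_poly_pCons)

lemma mat_poly_add: "mat_poly (p + q) A = mat_poly p A + mat_poly q A"
  for A :: "'a::comm_ring_1^'n^'n"
proof (induction p arbitrary: q)
  case (pCons a p)
  show ?case
    by (cases q) (simp add: mat_poly_pCons pCons.IH mat_add matrix_add_ldistrib)
qed simp

lemma mat_poly_smult: "mat_poly (smult a p) A = mat a ** mat_poly p A"
  for A :: "'a::comm_ring_1^'n^'n"
  by (induction p)
     (simp_all add: mat_poly_pCons mat_mult matrix_add_ldistrib matrix_mul_assoc mat_commutes[of A])

lemma mat_poly_diff: "mat_poly (p - q) A = mat_poly p A - mat_poly q A"
  for A :: "'a::comm_ring_1^'n^'n"
  using mat_poly_add[of "p - q" q A] by simp

lemma mat_poly_mult: "mat_poly (p * q) A = mat_poly p A ** mat_poly q A"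
  for A :: "'a::comm_ring_1^'n^'n"
  by (induction p)
     (simp_all add: mat_poly_pCons mat_poly_add mat_poly_smult matrix_add_rdistrib matrix_mul_assoc)

lemma mat_poly_commute: "mat_poly p A ** mat_poly q A = mat_poly q A ** mat_poly p A"
  for A :: "'a::comm_ring_1^'n^'n"
  by (metis mat_poly_mult mult.commute)

lemma mat_poly_monom: "mat_poly (monom a i) A = mat a ** mat_pow A i"
  for A :: "'a::comm_ring_1^'n^'n"
  by (induction i) (simp_all add: mat_poly_pCons monom_0 monom_Suc matrix_mul_assoc mat_commutes[of A])

lemma mat_poly_sum: "mat_poly (\<Sum>i\<in>I. f i) A = (\<Sum>i\<in>I. mat_poly (f i) A)"
  for A :: "'a::comm_ring_1^'n^'n"
  by (induction I rule: infinite_finite_induct) (simp_all add: mat_poly_add)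

lemma mat_poly_linear_power: "mat_poly ([:-c, 1:] ^ i) A = mat_pow (A - mat c) i"
  for A :: "'a::comm_ring_1^'n^'n"
proof -
  have "mat (- c) + A = A - mat c"
    by (simp add: vec_eq_iff mat_nth)
  then show ?thesis
    by (induction i) (simp_all only: power_0 power_Suc mat_poly_1 mat_pow_0 mat_pow_Suc mat_poly_mult mat_poly_linear)
qed

lemma mat_poly_eigenvector:
  fixes A :: "'a::comm_ring_1^'n^'n"
  assumes "A *v v = c *s v"
  shows "mat_poly p A *v v = poly p c *s v"
proof (induction p)
  case (pCons a p)
  have "mat_poly (pCons a p) A *v v = a *s v + A *v (mat_poly p A *v v)"
    by (simp add: mat_poly_pCons matrix_vector_mult_add_rdistrib mat_mult_vec matrix_vector_mul_assoc)
  also have "\<dots> = a *s v + poly p c *s (c *s v)"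
    by (simp add: pCons.IH matrix_vector_mult_scale assms)
  also have "\<dots> = poly (pCons a p) c *s v"
    by (simp add: vector_sadd_rdistrib vector_smult_assoc mult.commute)
  finally show ?case .
qed (simp add: vec_eq_iff)

section \<open>The minimal polynomial and the spectral index\<close>

text \<open>The matrices form a space of finite real dimension, so sufficiently many powers of
  \<open>A\<close> satisfy a nontrivial relation with real coefficients.\<close>

lemma annihilating_polynomial:
  fixes A :: "complex^'n^'n"
  obtains p where "p \<noteq> 0" "mat_poly p A = 0"
proof -
  define N where "N = DIM(complex^'n^'n)"
  let ?F = "mat_pow A"
  show thesis
  proof (cases "inj_on ?F {..N}")
    \<comment> \<open>Coinciding powers shrink the set of powers, so counting yields no dependence;
      a difference of two monomials annihilates \<open>A\<close> instead.\<close>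
    case False
    then obtain i j where ij: "i \<noteq> j" "?F i = ?F j"
      by (auto simp: inj_on_def)
    have "monom (1::complex) i - monom 1 j \<noteq> 0"
      using ij(1) by (metis coeff_monom eq_iff_diff_eq_0 zero_neq_one)
    moreover have "mat_poly (monom 1 i - monom 1 j) A = 0"
      using ij(2) by (simp add: mat_poly_diff mat_poly_monom)
    ultimately show thesis
      by (rule that)
  next
    case True
    then have "card (?F ` {..N}) = Suc N"
      by (simp add: card_image)
    then have "dependent (?F ` {..N})"
      by (metis N_def independent_bound lessI not_less)
    then obtain u where u: "\<exists>i\<le>N. u (?F i) \<noteq> 0" "(\<Sum>B\<in>?F ` {..N}. u B *\<^sub>R B) = 0"
      by (subst (asm) real_vector.dependent_finite) auto
    define p where "p = (\<Sum>i\<le>N. monom (complex_of_real (u (?F i))) i)"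
    have "coeff p i = of_real (u (?F i))" if "i \<le> N" for i
      using that by (simp add: p_def coeff_sum)
    then have "p \<noteq> 0"
      using u(1) by fastforce
    moreover have "mat_poly p A = (\<Sum>i\<le>N. u (?F i) *\<^sub>R ?F i)"
      unfolding p_def mat_poly_sum mat_poly_monom
      by (intro sum.cong refl) (simp add: mat_mul_left vec_eq_iff scaleR_conv_of_real[where 'a=complex])
    moreover have "\<dots> = 0"
      using u(2) True by (simp add: sum.reindex)
    ultimately show thesis
      using that by simp
  qed
qed

lemma minimal_polynomial:
  fixes A :: "complex^'n^'n"
  obtains m where "m \<noteq> 0" "mat_poly m A = 0"
    "\<And>q. q \<noteq> 0 \<Longrightarrow> mat_poly q A = 0 \<Longrightarrow> degree m \<le> degree q"
proof -
  let ?P = "\<lambda>q. q \<noteq> 0 \<and> mat_poly q A = 0"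
  obtain p where "?P p"
    using annihilating_polynomial by blast
  from arg_min_nat_lemma[of ?P, OF this, of degree] that show thesis
    by blast
qed

lemma finite_spectrum_of: "finite (spectrum_of A)"
proof -
  obtain p where p: "p \<noteq> 0" "mat_poly p A = 0"
    using annihilating_polynomial by blast
  have "poly p c = 0" if c: "c \<in> spectrum_of A" for c
  proof -
    obtain v where v: "v \<noteq> 0" "A *v v = c *s v"
      using c by (auto simp: spectrum_of_def)
    show ?thesis
      using mat_poly_eigenvector[OF v(2), of p] p(2) v(1) by simp
  qed
  then have "spectrum_of A \<subseteq> {c. poly p c = 0}"
    by blast
  then show ?thesis
    using poly_roots_finite[OF p(1)] by (rule finite_subset)
qed

lemma spec_index_eq_0:
  assumes "c \<notin> spectrum_of A"
  shows "spec_index A c = 0"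
  unfolding spec_index_def
proof (rule Least_eq_0, intro allI impI)
  fix v
  assume "mat_pow (A - mat c) (Suc 0) *v v = 0"
  then have "A *v v = c *s v"
    by (simp add: matrix_vector_mult_diff_rdistrib mat_mult_vec)
  with assms show "mat_pow (A - mat c) 0 *v v = 0"
    by (auto simp: spectrum_of_def)
qed

text \<open>The \<open>LEAST\<close> in \<open>spec_index\<close> is meaningful only if some
  exponent stops the growth of the kernels. The order of \<open>c\<close> in an annihilating
  polynomial is such an exponent.\<close>

lemma spec_index_kernel:
  fixes A :: "complex^'n^'n"
  assumes "mat_pow (A - mat c) (Suc (spec_index A c)) *v v = 0"
  shows "mat_pow (A - mat c) (spec_index A c) *v v = 0"
proof -
  obtain m where m: "m \<noteq> 0" "mat_poly m A = 0"
    using annihilating_polynomial by blast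
  define r where "r = order c m"
  obtain q where q: "m = [:-c, 1:] ^ r * q" "\<not> [:-c, 1:] dvd q"
    using order_decomp[OF m(1)] unfolding r_def by blast
  have "mat_pow (A - mat c) r *v x = 0" if "mat_pow (A - mat c) (Suc r) *v x = 0" for x
  proof -
    let ?w = "mat_pow (A - mat c) r *v x"
    have "(A - mat c) *v ?w = 0"
      using that by (simp add: matrix_vector_mul_assoc)
    then have "A *v ?w = c *s ?w"
      by (simp add: matrix_vector_mult_diff_rdistrib mat_mult_vec)
    then have "poly q c *s ?w = mat_poly q A *v ?w"
      by (rule mat_poly_eigenvector[symmetric])
    \<comment> \<open>The vector \<open>?w\<close> is zero or an eigenvector, so
      \<open>mat_poly q A\<close> scales it by \<open>poly q c\<close>, which is nonzero, while
      \<open>mat_poly m A\<close> is 0.\<close>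
    also have "\<dots> = mat_poly m A *v x"
      by (subst q(1), subst mult.commute) (simp only: mat_poly_mult mat_poly_linear_power matrix_vector_mul_assoc)
    finally show ?thesis
      using q(2) m(2) by (simp add: poly_eq_0_iff_dvd)
  qed
  then have "\<forall>v. mat_pow (A - mat c) (Suc r) *v v = 0 \<longrightarrow> mat_pow (A - mat c) r *v v = 0"
    by blast
  then have "\<forall>v. mat_pow (A - mat c) (Suc (spec_index A c)) *v v = 0 \<longrightarrow>
      mat_pow (A - mat c) (spec_index A c) *v v = 0"
    unfolding spec_index_def by (rule LeastI)
  with assms show ?thesis
    by blast
qed

lemma mat_pow_add: "mat_pow A (i + j) = mat_pow A i ** mat_pow A j"
  for A :: "'a::comm_ring_1^'n^'n"
  by (induction i) (simp_all add: matrix_mul_assoc)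

text \<open>Once two successive kernels agree, all later ones do. The induction hypothesis is
  applied to \<open>(A - mat c) *v v\<close>, which needs one power less.\<close>

lemma spec_index_kernel_le:
  fixes A :: "complex^'n^'n"
  assumes "spec_index A c \<le> e" "mat_pow (A - mat c) e *v v = 0"
  shows "mat_pow (A - mat c) (spec_index A c) *v v = 0"
  using assms
proof (induction e arbitrary: v rule: dec_induct)
  case (step e)
  let ?B = "A - mat c"
  have "mat_pow ?B (Suc e) = mat_pow ?B e ** ?B"
    using mat_pow_add[of ?B e 1] by simp
  then have "mat_pow ?B e *v (?B *v v) = 0"
    using step.prems by (simp only: matrix_vector_mul_assoc)
  then have "mat_pow ?B (spec_index A c) *v (?B *v v) = 0"
    by (rule step.IH)
  moreover have "mat_pow ?B (Suc (spec_index A c)) = mat_pow ?B (spec_index A c) ** ?B"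
    using mat_pow_add[of ?B "spec_index A c" 1] by simp
  ultimately have "mat_pow ?B (Suc (spec_index A c)) *v v = 0"
    by (simp only: matrix_vector_mul_assoc)
  then show ?case
    by (rule spec_index_kernel)
qed simp

text \<open>Otherwise a factor \<open>[:-c, 1:]\<close> could be removed from \<open>m\<close>, and
  since the kernels have already stabilized, the quotient would still annihilate
  \<open>A\<close>.\<close>

lemma order_minimal_polynomial_le:
  fixes A :: "complex^'n^'n"
  assumes m: "m \<noteq> 0" "mat_poly m A = 0"
    and min: "\<And>q. q \<noteq> 0 \<Longrightarrow> mat_poly q A = 0 \<Longrightarrow> degree m \<le> degree q"
  shows "order c m \<le> spec_index A c"
proof (rule ccontr)
  assume "\<not> ?thesis"
  then obtain e where e: "order c m = Suc e" "spec_index A c \<le> e"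
    by (cases "order c m") auto
  obtain q where q: "m = [:-c, 1:] ^ Suc e * q"
    using order_decomp[OF m(1), of c] unfolding e(1) by blast
  define m' where "m' = [:-c, 1:] ^ e * q"
  have m_eq: "m = [:-c, 1:] * m'"
    by (simp only: q m'_def power_Suc mult.assoc)
  then have "m' \<noteq> 0"
    using m(1) by auto
  moreover have "mat_poly m' A = 0"
  proof -
    have "mat_poly m' A *v v = 0" for v
    proof -
      let ?w = "mat_poly q A *v v"
      have "mat_pow (A - mat c) (Suc e) *v ?w = mat_poly m A *v v"
        by (subst q) (simp only: mat_poly_mult mat_poly_linear_power matrix_vector_mul_assoc)
      then have "mat_pow (A - mat c) (Suc e) *v ?w = 0"
        by (simp add: m)
      then have "mat_pow (A - mat c) (spec_index A c) *v ?w = 0"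
        using spec_index_kernel_le[of A c "Suc e"] e(2) by simp
      then have "mat_pow (A - mat c) (e - spec_index A c) *v (mat_pow (A - mat c) (spec_index A c) *v ?w) = 0"
        by simp
      then have "mat_pow (A - mat c) e *v ?w = 0"
        using e(2) mat_pow_add[of "A - mat c" "e - spec_index A c" "spec_index A c"]
        by (simp add: matrix_vector_mul_assoc matrix_mul_assoc)
      then show ?thesis
        by (simp only: m'_def mat_poly_mult mat_poly_linear_power matrix_vector_mul_assoc)
    qed
    then show ?thesis
      by (simp add: matrix_eq)
  qed
  ultimately have "degree m \<le> degree m'"
    by (rule min)
  moreover have "degree m = Suc (degree m')"
    using \<open>m' \<noteq> 0\<close> unfolding m_eq by (subst degree_mult_eq) auto
  ultimately show False
    by simp
qed

text \<open>The fundamental theorem of algebra supplies a root \<open>c\<close> of \<open>p\<close>,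
  and its linear factor is cancelled from both polynomials. This lowers the orders at
  \<open>c\<close> by one and keeps those at other points.\<close>

lemma dvd_if_order_le:
  fixes p q :: "complex poly"
  assumes "p \<noteq> 0" "\<And>c. [:-c, 1:] ^ order c p dvd q"
  shows "p dvd q"
  using assms
proof (induction "degree p" arbitrary: p q)
  case 0
  then show ?case
    by (metis is_unit_iff_degree unit_imp_dvd)
next
  case (Suc n)
  then obtain c where c: "poly p c = 0"
    using alg_closed_imp_poly_has_root[of p] by auto
  then obtain p' where p': "p = [:-c, 1:] * p'"
    by (auto simp: poly_eq_0_iff_dvd)
  have "order c p \<noteq> 0"
    using c Suc.prems(1) by (simp add: order_root)
  then have "[:-c, 1:] dvd q"
    using Suc.prems(2)[of c] by (meson dvd_power dvd_trans gr0I)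
  then obtain q' where q': "q = [:-c, 1:] * q'"
    by (elim dvdE)
  have "p' \<noteq> 0"
    using Suc.prems(1) p' by auto
  have "p' dvd q'"
  proof (rule Suc.hyps(1))
    show "n = degree p'"
      using Suc.hyps(2) \<open>p' \<noteq> 0\<close> unfolding p' by (subst (asm) degree_mult_eq) auto
    fix a
    show "[:-a, 1:] ^ order a p' dvd q'"
    proof (cases "a = c")
      case True
      have "order c p = Suc (order c p')"
        using Suc.prems(1) order_power_n_n[of c 1] unfolding p' by (subst order_mult) simp_all
      with Suc.prems(2)[of c] have "[:-c, 1:] * [:-c, 1:] ^ order c p' dvd [:-c, 1:] * q'"
        by (simp only: q' power_Suc)
      then show ?thesis
        unfolding True by (subst (asm) dvd_times_left_cancel_iff) auto
    next
      case False
      have *: "order a [:-c, 1:] = 0"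
        using False by (intro order_0I) auto
      have "order a p = order a p'"
        using Suc.prems(1) * unfolding p' by (subst order_mult) simp_all
      moreover have q0: "q = 0 \<longleftrightarrow> q' = 0"
        unfolding q' by (subst mult_eq_0_iff) simp
      moreover have "order a q = order a q'" if "q \<noteq> 0"
        using that * unfolding q' by (subst order_mult) simp_all
      ultimately show ?thesis
        using Suc.prems(2)[of a] q0 by (auto simp: order_divides)
    qed
  qed fact
  then show ?case
    unfolding p' q' by (rule mult_dvd_mono[OF dvd_refl])
qed

section \<open>Hermite interpolation\<close>

text \<open>In characteristic 0, differentiation lowers the order of a root by exactly one.
  Homogeneous Hermite conditions thereby become divisibility.\<close>

lemma linear_power_dvd_iff:
  fixes p :: "'a::field_char_0 poly"
  shows "[:-c, 1:] ^ n dvd p \<longleftrightarrow> (\<forall>j<n. poly ((pderiv ^^ j) p) c = 0)"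
proof (induction n arbitrary: p)
  case (Suc n)
  have "[:-c, 1:] ^ Suc n dvd p \<longleftrightarrow> poly p c = 0 \<and> [:-c, 1:] ^ n dvd pderiv p"
  proof (cases "p = 0 \<or> poly p c \<noteq> 0")
    case True
    then show ?thesis
      by (auto simp: order_divides order_0I simp del: power_Suc)
  next
    case False
    then have "order c p = Suc (order c (pderiv p))"
      using order_pderiv by blast
    moreover have "pderiv p \<noteq> 0"
      using False by (metis order_0I pderiv_iszero poly_pCons mult_zero_right add.right_neutral poly_0 pCons_0_0)
    ultimately show ?thesis
      using False by (simp add: order_divides del: power_Suc)
  qed
  then show ?case
    by (auto simp: Suc.IH funpow_Suc_right All_less_Suc2 simp del: power_Suc funpow.simps)
qed simp

text \<open>Newton's scheme: the conditions are met one at a time, node by node, and at each node by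
  increasing order of derivative.\<close>

lemma hermite_interpolation_exists:
  fixes a :: "'a::field_char_0 \<Rightarrow> nat \<Rightarrow> 'a" and m :: "'a \<Rightarrow> nat"
  assumes "finite S"
  shows "\<exists>p. \<forall>c\<in>S. \<forall>j<m c. poly ((pderiv ^^ j) p) c = a c j"
  using assms
proof (induction S rule: finite_induct)
  case (insert x S)
  define R where "R = (\<Prod>c\<in>S. [:-c, 1:] ^ m c)"
  have R_dvd: "[:-c, 1:] ^ m c dvd R" if "c \<in> S" for c
    unfolding R_def using insert.hyps(1) that by (rule dvd_prodI)
  have R_nz: "poly R x \<noteq> 0"
    using insert.hyps by (auto simp: R_def poly_prod)
  have "\<exists>p. (\<forall>c\<in>S. \<forall>j<m c. poly ((pderiv ^^ j) p) c = a c j) \<and>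
      (\<forall>j<n. poly ((pderiv ^^ j) p) x = a x j)" for n
  proof (induction n)
    case 0
    then show ?case
      using insert.IH by simp
  next
    case (Suc n)
    then obtain p where p: "\<forall>c\<in>S. \<forall>j<m c. poly ((pderiv ^^ j) p) c = a c j"
        "\<forall>j<n. poly ((pderiv ^^ j) p) x = a x j"
      by blast
    \<comment> \<open>\<open>T\<close> has zero data in every condition met so far but a nonzero
      \<open>n\<close>-th derivative at \<open>x\<close>, so a multiple of it repairs the next
      condition without disturbing the others.\<close>
    define T where "T = [:-x, 1:] ^ n * R"
    have T_S: "poly ((pderiv ^^ j) T) c = 0" if "c \<in> S" "j < m c" for c j
      using R_dvd[OF that(1)] linear_power_dvd_iff[of c "m c" T] that(2) by (simp add: T_def)
    have T_x: "\<forall>j<n. poly ((pderiv ^^ j) T) x = 0"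
      unfolding linear_power_dvd_iff[symmetric] by (simp add: T_def)
    have "\<not> [:-x, 1:] ^ Suc n dvd T"
    proof
      assume "[:-x, 1:] ^ Suc n dvd T"
      then have "[:-x, 1:] ^ n * [:-x, 1:] dvd [:-x, 1:] ^ n * R"
        by (simp only: T_def power_Suc2)
      then have "[:-x, 1:] dvd R"
        by (subst (asm) dvd_times_left_cancel_iff) auto
      with R_nz show False
        by (simp add: poly_eq_0_iff_dvd)
    qed
    with T_x have T_n: "poly ((pderiv ^^ n) T) x \<noteq> 0"
      unfolding linear_power_dvd_iff by (metis less_Suc_eq)
    define p' where "p' = p + smult ((a x n - poly ((pderiv ^^ n) p) x) / poly ((pderiv ^^ n) T) x) T"
    have "\<forall>c\<in>S. \<forall>j<m c. poly ((pderiv ^^ j) p') c = a c j"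
      using p(1) T_S by (simp add: p'_def higher_pderiv_add higher_pderiv_smult)
    moreover have "\<forall>j<Suc n. poly ((pderiv ^^ j) p') x = a x j"
      using p(2) T_x T_n by (auto simp: p'_def higher_pderiv_add higher_pderiv_smult less_Suc_eq)
    ultimately show ?case
      by blast
  qed
  from this[of "m x"] show ?case
    by auto
qed simp

section \<open>Primary matrix functions\<close>

text \<open>This makes the \<open>THE\<close> in \<open>mat_fun\<close> well defined: the difference
  of two interpolants is a multiple of the minimal polynomial.\<close>

lemma hermite_interpolates_unique:
  fixes A :: "complex^'n^'n"
  assumes "hermite_interpolates p f A" "hermite_interpolates q f A"
  shows "mat_poly p A = mat_poly q A"
proof -
  obtain m where m: "m \<noteq> 0" "mat_poly m A = 0"
    and min: "\<And>q. q \<noteq> 0 \<Longrightarrow> mat_poly q A = 0 \<Longrightarrow> degree m \<le> degree q"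
    using minimal_polynomial by blast
  have diff: "(pderiv ^^ j) (p - q) = (pderiv ^^ j) p - (pderiv ^^ j) q" for j
    using higher_pderiv_add[of j "p - q" q] by simp
  have "[:-c, 1:] ^ spec_index A c dvd p - q" for c
    \<comment> \<open>Off the spectrum the index is 0 and the divisibility is trivial.\<close>
    using assms spec_index_eq_0[of c A]
    by (cases "c \<in> spectrum_of A") (auto simp: hermite_interpolates_def linear_power_dvd_iff diff)
  then have "[:-c, 1:] ^ order c m dvd p - q" for c
    using order_minimal_polynomial_le[OF m min, of c] by (meson dvd_trans le_imp_power_dvd)
  then have "m dvd p - q"
    by (rule dvd_if_order_le[OF m(1)])
  then have "mat_poly (p - q) A = 0"
    using m(2) by (auto simp: mat_poly_mult)
  then show ?thesis
    by (simp add: mat_poly_diff)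
qed

text \<open>\<open>deriv\<close> is total, so there are values to prescribe for every
  \<open>f\<close>, analytic or not.\<close>

lemma hermite_interpolates_exists: "\<exists>p. hermite_interpolates p f A"
  unfolding hermite_interpolates_def
  by (rule hermite_interpolation_exists[OF finite_spectrum_of])

lemma mat_fun_eq_mat_poly:
  assumes "f analytic_on spectrum_of A" "hermite_interpolates p f A"
  shows "mat_fun f A = mat_poly p A"
  unfolding mat_fun_def using assms hermite_interpolates_unique
  by (auto intro!: the_equality)

lemma mat_fun_not_analytic: "\<not> f analytic_on spectrum_of A \<Longrightarrow> mat_fun f A = 0"
  by (simp add: mat_fun_def)

lemma higher_deriv_poly: "(deriv ^^ j) (poly p) = poly ((pderiv ^^ j) p)"
  for p :: "'a::real_normed_field poly"
proof (induction j)
  case (Suc j)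
  show ?case
    by (simp add: Suc.IH fun_eq_iff DERIV_imp_deriv)
qed simp

text \<open>By the Leibniz rule, the \<open>j\<close>-th derivative of a product at \<open>c\<close>
  involves only derivatives up to order \<open>j\<close>, where \<open>p\<close> and
  \<open>f\<close> agree. The rule requires \<open>f\<close> to be analytic at
  \<open>c\<close>.\<close>

lemma hermite_interpolates_poly_mult:
  assumes "f analytic_on spectrum_of A" "hermite_interpolates p f A"
  shows "hermite_interpolates (q * p) (\<lambda>z. poly q z * f z) A"
  unfolding hermite_interpolates_def
proof (intro ballI allI impI)
  fix c j
  assume c: "c \<in> spectrum_of A" and j: "j < spec_index A c"
  have an: "f analytic_on {c}"
    by (rule analytic_on_subset[OF assms(1)]) (simp add: c)
  have poly_an: "poly r analytic_on {c}" for r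
    by (rule analytic_on_subset[of _ UNIV]) (auto simp: analytic_on_open intro!: holomorphic_intros)
  have "poly (q * p) = (\<lambda>z. poly q z * poly p z)"
    by (simp add: fun_eq_iff)
  then have "poly ((pderiv ^^ j) (q * p)) c = (deriv ^^ j) (\<lambda>z. poly q z * poly p z) c"
    by (simp flip: higher_deriv_poly)
  also have "\<dots> = (deriv ^^ j) (\<lambda>z. poly q z * f z) c"
    using assms(2) c j
    by (auto simp: higher_deriv_mult_at an poly_an hermite_interpolates_def higher_deriv_poly intro!: sum.cong)
  finally show "poly ((pderiv ^^ j) (q * p)) c = (deriv ^^ j) (\<lambda>z. poly q z * f z) c" .
qed

text \<open>The indeterminate times an interpolant of \<open>f\<close> interpolates
  \<open>\<lambda>z. z * f z\<close>.\<close>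

lemma mat_fun_mult_id:
  assumes "f analytic_on spectrum_of A"
  shows "mat_fun (\<lambda>z. z * f z) A = mat_fun f A ** A"
proof -
  obtain p where p: "hermite_interpolates p f A"
    using hermite_interpolates_exists by blast
  have "hermite_interpolates ([:0, 1:] * p) (\<lambda>z. z * f z) A"
    using hermite_interpolates_poly_mult[OF assms p, of "[:0, 1:]"] by simp
  moreover have "(\<lambda>z. z * f z) analytic_on spectrum_of A"
    using assms by (intro analytic_intros)
  ultimately have "mat_fun (\<lambda>z. z * f z) A = mat_poly ([:0, 1:] * p) A"
    by (rule mat_fun_eq_mat_poly[rotated])
  also have "\<dots> = mat_poly p A ** mat_poly [:0, 1:] A"
    by (simp only: mat_poly_mult mat_poly_commute)
  also have "\<dots> = mat_fun f A ** A"
    by (simp add: mat_fun_eq_mat_poly[OF assms p] mat_poly_linear)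
  finally show ?thesis .
qed

section \<open>Invariance of primary matrix functions under similarity\<close>

context
  fixes A P Q :: "complex^'n^'n"
  assumes PQ: "P ** Q = mat 1" and QP: "Q ** P = mat 1"
begin

lemma mat_pow_similar: "mat_pow (Q ** A ** P) i = Q ** mat_pow A i ** P"
proof (induction i)
  case (Suc i)
  have "mat_pow (Q ** A ** P) (Suc i) = Q ** A ** (P ** Q) ** mat_pow A i ** P"
    by (simp add: Suc.IH matrix_mul_assoc)
  then show ?case
    by (simp add: PQ matrix_mul_assoc)
qed (simp add: QP)

lemma mat_poly_similar: "mat_poly p (Q ** A ** P) = Q ** mat_poly p A ** P"
proof (induction p)
  case (pCons a p)
  have "mat_poly (pCons a p) (Q ** A ** P) = mat a ** (Q ** P) + Q ** A ** (P ** Q) ** mat_poly p A ** P"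
    by (simp add: mat_poly_pCons pCons.IH matrix_mul_assoc QP)
  also have "\<dots> = Q ** (mat a + A ** mat_poly p A) ** P"
    by (simp add: PQ matrix_add_ldistrib matrix_add_rdistrib matrix_mul_assoc mat_commutes[of Q])
  finally show ?case
    by (simp add: mat_poly_pCons)
qed simp

lemma similar_mult_eq_0_iff: "(Q ** B ** P) *v v = 0 \<longleftrightarrow> B *v (P *v v) = 0"
proof
  assume "(Q ** B ** P) *v v = 0"
  then have "P *v ((Q ** B ** P) *v v) = 0"
    by simp
  then have "(P ** Q) *v (B *v (P *v v)) = 0"
    by (simp add: matrix_vector_mul_assoc matrix_mul_assoc)
  then show "B *v (P *v v) = 0"
    by (simp add: PQ)
next
  assume "B *v (P *v v) = 0"
  then have "Q *v (B *v (P *v v)) = 0"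
    by simp
  then show "(Q ** B ** P) *v v = 0"
    by (simp add: matrix_vector_mul_assoc matrix_mul_assoc)
qed

lemma similar_diff_mat: "Q ** A ** P - mat c = Q ** (A - mat c) ** P"
proof -
  have "Q ** mat c ** P = mat c"
    by (metis QP mat_commutes matrix_mul_assoc matrix_mul_rid)
  moreover have "Q ** A ** P = Q ** (A - mat c) ** P + Q ** mat c ** P"
    by (simp flip: matrix_add_rdistrib matrix_add_ldistrib)
  ultimately show ?thesis
    by simp
qed

end

text \<open>\<open>P\<close> is surjective because \<open>Q\<close> is a right inverse.\<close>

lemma all_vec_similar:
  fixes P Q :: "complex^'n^'n"
  assumes "P ** Q = mat 1"
  shows "(\<forall>v. R (P *v v)) \<longleftrightarrow> (\<forall>v. R v)"
  by (metis assms matrix_vector_mul_assoc matrix_vector_mul_lid)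

lemma spectrum_of_altdef: "spectrum_of A = {c. \<exists>v. v \<noteq> 0 \<and> (A - mat c) *v v = 0}"
  by (simp add: spectrum_of_def matrix_vector_mult_diff_rdistrib mat_mult_vec)

lemma spectrum_of_similar:
  fixes A P Q :: "complex^'n^'n"
  assumes PQ: "P ** Q = mat 1" and QP: "Q ** P = mat 1"
  shows "spectrum_of (Q ** A ** P) = spectrum_of A"
proof -
  have P0: "P *v v = 0 \<longleftrightarrow> v = 0" for v
    using similar_mult_eq_0_iff[OF PQ QP, of "mat 1" v] by (simp add: QP)
  have "(\<forall>v. (Q ** A ** P - mat c) *v v = 0 \<longrightarrow> v = 0) \<longleftrightarrow> (\<forall>v. (A - mat c) *v v = 0 \<longrightarrow> v = 0)" for c
    using all_vec_similar[OF PQ, of "\<lambda>v. (A - mat c) *v v = 0 \<longrightarrow> v = 0"]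
    by (simp add: similar_diff_mat[OF PQ QP] similar_mult_eq_0_iff[OF PQ QP] P0)
  then show ?thesis
    unfolding spectrum_of_altdef by blast
qed

lemma spec_index_similar:
  fixes A P Q :: "complex^'n^'n"
  assumes PQ: "P ** Q = mat 1" and QP: "Q ** P = mat 1"
  shows "spec_index (Q ** A ** P) c = spec_index A c"
  unfolding spec_index_def similar_diff_mat[OF PQ QP] mat_pow_similar[OF PQ QP]
    similar_mult_eq_0_iff[OF PQ QP]
  by (subst all_vec_similar[OF PQ]) (rule refl)

text \<open>Spectrum and indices are invariant, so one interpolant serves both matrices; if
  \<open>f\<close> is not analytic on the spectrum, both sides are 0 by convention.\<close>

lemma mat_fun_similar:
  fixes A P Q :: "complex^'n^'n"
  assumes PQ: "P ** Q = mat 1" and QP: "Q ** P = mat 1"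
  shows "mat_fun f (Q ** A ** P) = Q ** mat_fun f A ** P"
proof (cases "f analytic_on spectrum_of A")
  case True
  obtain p where p: "hermite_interpolates p f A"
    using hermite_interpolates_exists by blast
  then have "hermite_interpolates p f (Q ** A ** P)"
    by (simp add: hermite_interpolates_def spectrum_of_similar[OF assms] spec_index_similar[OF assms])
  then have "mat_fun f (Q ** A ** P) = mat_poly p (Q ** A ** P)"
    using True by (intro mat_fun_eq_mat_poly) (simp_all add: spectrum_of_similar[OF assms])
  then show ?thesis
    by (simp add: mat_poly_similar[OF assms] mat_fun_eq_mat_poly[OF True p])
next
  case False
  then show ?thesis
    by (simp add: mat_fun_not_analytic spectrum_of_similar[OF assms])
qed

section \<open>Fractional powers\<close>

text \<open>Since \<open>powr\<close> maps 0 to 0, continuity would force the limit 0, but for a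
  negative exponent the modulus is at least 1 on the reals between 0 and 1.\<close>

lemma powr_not_analytic_at_0:
  fixes r :: real
  assumes "r < 0"
  shows "\<not> (\<lambda>z. z powr complex_of_real r) analytic_on {0}"
proof
  assume "(\<lambda>z. z powr complex_of_real r) analytic_on {0}"
  then have "isCont (\<lambda>z. z powr complex_of_real r) 0"
    by (intro analytic_at_imp_isCont)
  then have "((\<lambda>z. z powr complex_of_real r) \<longlongrightarrow> 0) (at 0)"
    by (simp add: isCont_def)
  moreover have "filterlim complex_of_real (at 0) (at_right 0)"
    by (auto simp: filterlim_at eventually_at_filter intro!: tendsto_eq_intros)
  ultimately have "((\<lambda>x. complex_of_real x powr complex_of_real r) \<longlongrightarrow> 0) (at_right 0)"
    by (rule filterlim_compose)
  then have "((\<lambda>x. norm (complex_of_real x powr complex_of_real r)) \<longlongrightarrow> 0) (at_right 0)"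
    by (rule tendsto_norm_zero)
  moreover have "\<forall>\<^sub>F x in at_right 0. norm (complex_of_real x powr complex_of_real r) \<ge> 1"
  proof -
    have "\<forall>\<^sub>F x::real in at_right 0. x \<in> {0<..<1}"
      by (rule eventually_at_right_real) simp
    then show ?thesis
    proof eventually_elim
      case (elim x)
      then have "norm (complex_of_real x powr complex_of_real r) = x powr r"
        by (simp add: norm_powr_real_powr)
      also have "x powr r \<ge> 1 powr r"
        using elim assms by (intro powr_mono2') auto
      finally show ?case
        by simp
    qed
  qed
  ultimately have "(0::real) \<ge> 1"
    by (rule tendsto_lowerbound) simp
  then show False
    by simp
qed

lemma mat_fun_powr_minus_1:
  fixes A :: "complex^'n^'n"
  assumes "s < 1"
  shows "mat_fun (\<lambda>z. z powr complex_of_real (s - 1)) A =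
    mat_fun (\<lambda>z. z powr complex_of_real (s - 2)) A ** A"
proof -
  let ?f = "\<lambda>z. z powr complex_of_real (s - 2)" and ?g = "\<lambda>z. z powr complex_of_real (s - 1)"
  \<comment> \<open>This includes \<open>z = 0\<close>, where both powers are 0.\<close>
  have g: "?g = (\<lambda>z. z * ?f z)"
  proof
    fix z
    show "?g z = z * ?f z"
      using powr_add[of z 1 "complex_of_real (s - 2)"] by (cases "z = 0") (simp_all add: algebra_simps)
  qed
  show ?thesis
  proof (cases "?f analytic_on spectrum_of A")
    case True
    then show ?thesis
      unfolding g by (rule mat_fun_mult_id)
  next
    case False
    \<comment> \<open>An analytic \<open>?g\<close> would keep 0 out of the spectrum, and then
      \<open>?f\<close>, being \<open>?g z / z\<close>, would be analytic as well.\<close>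
    have "\<not> ?g analytic_on spectrum_of A"
    proof
      assume an: "?g analytic_on spectrum_of A"
      then have "0 \<notin> spectrum_of A"
        using powr_not_analytic_at_0[of "s - 1"] assms analytic_on_subset by fastforce
      then have "(\<lambda>z. ?g z / z) analytic_on spectrum_of A"
        by (intro analytic_on_divide an analytic_on_id) auto
      moreover have "(\<lambda>z. ?g z / z) = ?f"
      proof
        fix z
        show "?g z / z = ?f z"
          using fun_cong[OF g, of z] by (cases "z = 0") simp_all
      qed
      ultimately show False
        using False by simp
    qed
    with False show ?thesis
      by (simp add: mat_fun_not_analytic)
  qed
qed

section \<open>Real matrices inside complex matrices\<close>

lemma cmat_mult: "cmat (A ** B) = cmat A ** cmat B"
  by (simp add: vec_eq_iff matrix_matrix_mult_def)

lemma cmat_mult_vec: "cvec (A *v x) = cmat A *v cvec x"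
  by (simp add: vec_eq_iff matrix_vector_mult_def cvec_def)

lemma cmat_mat_1: "cmat (mat 1) = mat 1"
  by (simp add: vec_eq_iff mat_nth)

section \<open>Orthonormal bases\<close>

lemma transpose_mult_orthonormal:
  assumes "orthonormal_basis_columns V S"
  shows "transpose V ** V = mat 1"
  using assms by (simp add: orthonormal_basis_columns_def matrix_mult_transpose_dot_column vec_eq_iff mat_nth)

text \<open>An element of \<open>S\<close> has the form \<open>V *v y\<close>, and
  \<open>transpose V ** V\<close> cancels in the middle.\<close>

lemma orthonormal_proj:
  fixes V :: "real^'m^'n"
  assumes V: "orthonormal_basis_columns V S" and "x \<in> S"
  shows "V *v (transpose V *v x) = x"
proof -
  have "columns V \<subseteq> range ((*v) V)"
    by (auto simp: columns_def simp flip: matrix_vector_mult_basis)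
  then have "span (columns V) \<subseteq> range ((*v) V)"
    by (rule span_minimal) (intro linear_subspace_image matrix_vector_mul_linear subspace_UNIV)
  then obtain y where y: "x = V *v y"
    using assms by (auto simp: orthonormal_basis_columns_def)
  have "V *v (transpose V *v x) = V *v ((transpose V ** V) *v y)"
    by (simp only: y matrix_vector_mul_assoc matrix_mul_assoc)
  then show ?thesis
    by (simp add: y transpose_mult_orthonormal[OF V])
qed

lemma column_in_orthonormal_basis:
  assumes "orthonormal_basis_columns V S"
  shows "column i V \<in> S"
  using assms by (auto simp: orthonormal_basis_columns_def columns_def intro: span_base)

lemma orthonormal_change_of_basis:
  fixes V W :: "real^'m^'n"
  assumes V: "orthonormal_basis_columns V S" and W: "orthonormal_basis_columns W S"
  shows "V ** (transpose V ** W) = W"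
proof -
  have "column j (V ** (transpose V ** W)) = column j W" for j
    using orthonormal_proj[OF V column_in_orthonormal_basis[OF W], of j]
    by (simp add: vec_eq_iff column_def matrix_matrix_mult_def matrix_vector_mult_def)
  then show ?thesis
    by (simp add: vec_eq_iff column_def)
qed

text \<open>The type of the column index determines the dimension, which later turns an inclusion of
  two such spaces into an equality.\<close>

lemma dim_orthonormal_basis:
  fixes V :: "real^'m^'n"
  assumes "orthonormal_basis_columns V S"
  shows "dim S = CARD('m)"
proof -
  have ortho: "column i V \<bullet> column j V = (if i = j then 1 else 0)" for i j
    using assms by (simp add: orthonormal_basis_columns_def)
  have inj: "inj (\<lambda>j. column j V)"
    by (rule injI) (metis ortho zero_neq_one)
  have "columns V = range (\<lambda>j. column j V)"
    by (auto simp: columns_def)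
  moreover from this have "independent (columns V)"
    by (intro pairwise_orthogonal_independent)
       (auto simp: pairwise_def orthogonal_def ortho, metis ortho inner_zero_left zero_neq_one)
  ultimately show ?thesis
    using assms inj by (auto simp: orthonormal_basis_columns_def dim_eq_card_independent card_image)
qed

lemma orthonormal_basis_subspace: "orthonormal_basis_columns V S \<Longrightarrow> subspace S"
  by (auto simp: orthonormal_basis_columns_def)

section \<open>The reduced basis space as a rational Krylov space\<close>

lemma matrix_inv_mult:
  fixes A :: "'a::semiring_1^'n^'n"
  assumes "invertible A"
  shows "matrix_inv A ** A = mat 1" "A ** matrix_inv A = mat 1"
  using someI_ex[OF assms[unfolded invertible_def]] by (simp_all add: matrix_inv_def)

lemma matrix_inv_mult_vec:
  fixes A :: "'a::comm_ring_1^'n^'n"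
  assumes "invertible A"
  shows "A *v (matrix_inv A *v x) = x" "matrix_inv A *v (A *v x) = x"
  by (simp_all add: matrix_vector_mul_assoc matrix_inv_mult[OF assms])

lemma invertible_if_ker_trivial:
  fixes A :: "real^'n^'n"
  assumes "\<And>x. A *v x = 0 \<Longrightarrow> x = 0"
  shows "invertible A"
  unfolding invertible_left_inverse matrix_left_invertible_ker using assms by blast

lemma spd_invertible: "spd A \<Longrightarrow> invertible A"
  by (rule invertible_if_ker_trivial) (metis inner_zero_right less_irrefl spd_def)

text \<open>\<open>L\<close> need not be symmetric, but \<open>M ** (mat r + L)\<close> equals
  \<open>mat r ** M + K\<close>, whose quadratic form is positive at nonzero vectors.\<close>

lemma invertible_shift:
  assumes K: "spd K" and M: "spd M" and L: "L = matrix_inv M ** K" and "0 \<le> (r::real)"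
  shows "invertible (mat r + L)"
proof (rule invertible_if_ker_trivial, rule ccontr)
  fix x
  assume "(mat r + L) *v x = 0" and "x \<noteq> 0"
  then have "M *v (r *s x + L *v x) = 0"
    by (simp add: matrix_vector_mult_add_rdistrib mat_mult_vec)
  moreover have "M *v (L *v x) = K *v x"
    by (simp add: L matrix_vector_mul_assoc[symmetric] matrix_inv_mult_vec spd_invertible[OF M])
  ultimately have "r *s (M *v x) + K *v x = 0"
    by (simp add: matrix_vector_right_distrib matrix_vector_mult_scale)
  then have "r * (x \<bullet> (M *v x)) + x \<bullet> (K *v x) = 0"
    by (metis inner_right_distrib inner_scaleR_right inner_zero_right scalar_mult_eq_scaleR)
  moreover have "0 \<le> r * (x \<bullet> (M *v x))" "0 < x \<bullet> (K *v x)"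
    using K M \<open>x \<noteq> 0\<close> \<open>0 \<le> r\<close> by (auto simp: spd_def less_imp_le)
  ultimately show False
    by simp
qed

lemma mat_poly_krylov:
  fixes A :: "real^'n^'n"
  assumes "degree p \<le> k"
  shows "mat_poly p A *v c \<in> span ((\<lambda>i. mat_pow A i *v c) ` {..k})"
proof -
  have "mat_poly p A *v c = (\<Sum>i\<le>k. coeff p i *\<^sub>R (mat_pow A i *v c))"
    unfolding mat_poly_eq_sum[OF assms]
    by (induction k) (simp_all add: matrix_vector_mult_add_rdistrib mat_mult_vec scalar_mult_eq_scaleR
        flip: matrix_vector_mul_assoc)
  also have "\<dots> \<in> span ((\<lambda>i. mat_pow A i *v c) ` {..k})"
    by (intro span_sum span_scale span_base imageI)
  finally show ?thesis .
qed

lemma invertible_mat_poly_prod: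
  fixes A :: "'a::comm_ring_1^'n^'n"
  assumes "\<And>j. j \<in> J \<Longrightarrow> invertible (mat_poly (f j) A)"
  shows "invertible (mat_poly (\<Prod>j\<in>J. f j) A)"
  using assms
proof (induction J rule: infinite_finite_induct)
  case (insert x F)
  then show ?case
    by (simp add: mat_poly_mult invertible_mult)
qed (auto simp: invertible_def intro: exI[of _ "mat 1"])

section \<open>Poles, snapshots and the inclusion into the rational Krylov space\<close>

context
  fixes K M L A :: "real^'n^'n" and b :: "real^'n" and k :: nat and t d :: "nat \<Rightarrow> ereal"
  assumes K: "spd K" and M: "spd M" and L: "L = matrix_inv M ** K" and A: "A = matrix_inv L"
    and t_nonneg: "\<And>j. j \<le> k \<Longrightarrow> 0 \<le> t j"
    and d: "\<And>j. j \<le> k \<Longrightarrow> d j = - (1 / t j)"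
begin

lemma invertible_L: "invertible L"
  using invertible_shift[OF K M L, of 0] by simp

lemma invertible_A: "invertible A"
  using matrix_inv_mult[OF invertible_L] by (auto simp: invertible_def A)

text \<open>This ties the pole \<open>- r\<close> to the snapshot parameter \<open>1 / r\<close>: up
  to invertible factors, the shifted inverse of \<open>L\<close> is a shift of
  \<open>L\<close>.\<close>

lemma A_shift_eq: "r \<noteq> 0 \<Longrightarrow> mat r + A = mat r ** (A ** (mat (1 / r) + L))"
  by (simp add: matrix_add_ldistrib matrix_inv_mult(1)[OF invertible_L, folded A] mat_commutes[of A]
      matrix_mul_assoc flip: mat_mult)

lemma invertible_mat: "r \<noteq> 0 \<Longrightarrow> invertible (mat r :: real^'n^'n)"
  unfolding invertible_def by (rule exI[of _ "mat (1 / r)"]) (simp flip: mat_mult)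

text \<open>Extended arithmetic has \<open>1 / \<infinity> = 0\<close> and
  \<open>1 / 0 = \<infinity>\<close>, which produces the two exceptional poles.\<close>

lemma pole_cases:
  assumes "j \<le> k"
  obtains (infinite) "t j = \<infinity>" "d j = 0"
    | (zero) "t j = 0" "d j = -\<infinity>"
    | (pos) r where "0 < r" "t j = ereal r" "d j = ereal (- (1 / r))"
proof (cases "t j")
  case (real r)
  show thesis
  proof (cases "r = 0")
    case True
    then show thesis
      using zero d[OF assms] real by (simp add: divide_ereal_def zero_ereal_def[symmetric])
  next
    case False
    then show thesis
      using pos[of r] d[OF assms] t_nonneg[OF assms] real by (simp add: one_ereal_def)
  qed
qed (use infinite d[OF assms] t_nonneg[OF assms] in auto)

lemma invertible_pole_factor:
  assumes "j \<le> k" "d j \<noteq> -\<infinity>"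
  shows "invertible (mat_poly [:- real_of_ereal (d j), 1:] A)"
  using assms(1)
proof (cases rule: pole_cases)
  case infinite
  then show ?thesis
    by (simp add: mat_poly_linear invertible_A)
next
  case (pos r)
  then have "mat_poly [:- real_of_ereal (d j), 1:] A = mat (1 / r) ** (A ** (mat r + L))"
    using A_shift_eq[of "1 / r"] by (simp add: mat_poly_linear)
  then show ?thesis
    using pos by (simp add: invertible_mult invertible_mat invertible_A invertible_shift[OF K M L])
qed (use assms in simp)

text \<open>The factor of its own pole cancels the resolvent in a snapshot. For the snapshot at
  infinity there is no resolvent, and the factor is \<open>A\<close> itself.\<close>

lemma pole_factor_snapshot:
  assumes "j \<le> k" "d j \<noteq> -\<infinity>"
  shows "\<exists>\<alpha>. mat_poly [:- real_of_ereal (d j), 1:] A *v rb_snapshot L b (t j) = \<alpha> *s (A *v b)"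
  using assms(1)
proof (cases rule: pole_cases)
  case infinite
  then show ?thesis
    by (intro exI[of _ 1]) (simp add: mat_poly_linear rb_snapshot_def)
next
  case (pos r)
  then have "mat_poly [:- real_of_ereal (d j), 1:] A = mat (1 / r) ** (A ** (mat r + L))"
    using A_shift_eq[of "1 / r"] by (simp add: mat_poly_linear)
  then have "mat_poly [:- real_of_ereal (d j), 1:] A *v rb_snapshot L b (t j) = (1 / r) *s (A *v b)"
    using pos by (simp add: rb_snapshot_def mat_mult_vec matrix_inv_mult_vec invertible_shift[OF K M L]
        flip: matrix_vector_mul_assoc)
  then show ?thesis
    by blast
qed (use assms in simp)

text \<open>Once the \<open>j\<close>-th factor of the denominator has cancelled the resolvent, the
  other factors form a polynomial of degree at most \<open>k\<close> acting on
  \<open>A *v b\<close>.\<close>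

lemma snapshot_in_rational_krylov:
  assumes j: "j \<le> k"
  shows "rb_snapshot L b (t j) \<in> rational_krylov A (A *v b) d k"
proof -
  let ?J = "{i. i \<le> k \<and> d i \<noteq> -\<infinity>}" and ?l = "\<lambda>i. [:- real_of_ereal (d i), 1:]"
  define q where "q = krylov_denom d k"
  have q: "q = (\<Prod>i\<in>?J. ?l i)"
    by (simp add: q_def krylov_denom_def)
  have inv: "invertible (mat_poly q A)"
    unfolding q by (rule invertible_mat_poly_prod) (simp add: invertible_pole_factor)
  \<comment> \<open>Without \<open>j\<close>, at most \<open>k\<close> of the \<open>k + 1\<close>
    indices remain.\<close>
  have deg: "degree (\<Prod>i\<in>?J - {j}. ?l i) \<le> k"
  proof -
    have "card (?J - {j}) \<le> card ({..k} - {j})"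
      by (rule card_mono) auto
    also have "\<dots> = k"
      using j by (simp add: card_Diff_singleton)
    finally show ?thesis
      by (simp add: degree_prod_eq_sum_degree)
  qed
  have "\<exists>p. degree p \<le> k \<and> mat_poly q A *v rb_snapshot L b (t j) = mat_poly p A *v (A *v b)"
  proof (cases "d j = -\<infinity>")
    \<comment> \<open>Here \<open>j\<close> contributes no factor, so the bound \<open>deg\<close>
      covers \<open>q\<close> itself, and the snapshot is already \<open>A *v b\<close>.\<close>
    case True
    with j have "t j = 0"
      by (cases rule: pole_cases) auto
    then have "rb_snapshot L b (t j) = A *v b"
      by (simp add: rb_snapshot_def A)
    moreover have "degree q \<le> k"
      using deg True by (simp add: q)
    ultimately show ?thesis
      by auto
  next
    case False
    then obtain \<alpha> where \<alpha>: "mat_poly (?l j) A *v rb_snapshot L b (t j) = \<alpha> *s (A *v b)"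
      using pole_factor_snapshot[OF j] by blast
    have "q = (\<Prod>i\<in>?J - {j}. ?l i) * ?l j"
      unfolding q using j False by (subst prod.remove[of ?J j]) (simp_all add: mult.commute)
    then have "mat_poly q A *v rb_snapshot L b (t j) =
        mat_poly (\<Prod>i\<in>?J - {j}. ?l i) A *v (mat_poly (?l j) A *v rb_snapshot L b (t j))"
      by (simp only: mat_poly_mult matrix_vector_mul_assoc)
    also have "\<dots> = mat_poly (smult \<alpha> (\<Prod>i\<in>?J - {j}. ?l i)) A *v (A *v b)"
      by (simp only: \<alpha> matrix_vector_mult_scale mat_poly_smult mat_mult_vec flip: matrix_vector_mul_assoc)
    finally show ?thesis
      using deg degree_smult_le order_trans by blast
  qed
  then have "mat_poly q A *v rb_snapshot L b (t j) \<in> span ((\<lambda>i. mat_pow A i *v (A *v b)) ` {..k})"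
    using mat_poly_krylov by fastforce
  then have "matrix_inv (mat_poly q A) *v (mat_poly q A *v rb_snapshot L b (t j))
      \<in> rational_krylov A (A *v b) d k"
    unfolding rational_krylov_def q_def by blast
  then show ?thesis
    by (simp only: matrix_inv_mult_vec[OF inv])
qed

lemma rb_space_subset_rational_krylov: "rb_space L b t k \<subseteq> rational_krylov A (A *v b) d k"
proof -
  have "subspace (rational_krylov A (A *v b) d k)"
    unfolding rational_krylov_def by (intro linear_subspace_image matrix_vector_mul_linear subspace_span)
  then show ?thesis
    unfolding rb_space_def using snapshot_in_rational_krylov by (intro span_minimal) auto
qed

end

theorem theorem5:
  fixes K M L :: "real^'n^'n"
    and b :: "real^'n"
    and s :: real
    and k :: nat
    and t d :: "nat \<Rightarrow> ereal"
    and V W :: "real^'m^'n"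
  assumes "spd K" and "spd M" and "L = matrix_inv M ** K"
    and "0 < s" and "s < 1"
    and "CARD('m) = k + 1"
    and "\<And>j. j \<le> k \<Longrightarrow> 0 \<le> t j"
    and "inj_on t {..k}"
    and "\<And>j. j \<le> k \<Longrightarrow> d j = - (1 / t j)"
    and "orthonormal_basis_columns V (rb_space L b t k)"
    and "orthonormal_basis_columns W
           (rational_krylov (matrix_inv L) (matrix_inv L *v b) d k)"
    and "\<exists>j\<le>k. t j = \<infinity>"
  shows "dual_rb_approx L b s V =
    cmat (matrix_inv L) *v
      krylov_approx (\<lambda>z. z powr complex_of_real (s - 2)) (matrix_inv L) (matrix_inv L *v b) W"
proof -
  let ?A = "matrix_inv L" and ?S = "rb_space L b t k" and ?f = "\<lambda>z. z powr complex_of_real (s - 2)"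
  note V = assms(10) and W' = assms(11)
  \<comment> \<open>Both spaces have an orthonormal basis indexed by the same type, so one inclusion suffices.\<close>
  have "?S = rational_krylov ?A (?A *v b) d k"
    using rb_space_subset_rational_krylov[OF assms(1-3) refl assms(7,9)] dim_orthonormal_basis[OF V]
      dim_orthonormal_basis[OF W'] orthonormal_basis_subspace[OF V] orthonormal_basis_subspace[OF W']
    by (intro subspace_dim_equal) auto
  with W' have W: "orthonormal_basis_columns W ?S"
    by simp
  define Q where "Q = transpose V ** W"
  have W_eq: "W = V ** Q"
    unfolding Q_def by (rule orthonormal_change_of_basis[OF V W, symmetric])
  have "transpose Q ** Q = transpose W ** (V ** (transpose V ** W))"
    by (simp add: Q_def matrix_transpose_mul matrix_mul_assoc)
  then have QQ: "transpose Q ** Q = mat 1"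
    by (simp add: orthonormal_change_of_basis[OF V W] transpose_mult_orthonormal[OF W])
  \<comment> \<open>\<open>Q\<close> is square, so its left inverse is also a right inverse.\<close>
  then have QQ': "Q ** transpose Q = mat 1"
    by (simp add: matrix_left_right_inverse)
  define H where "H = transpose V ** ?A ** V"
  have "transpose W ** ?A ** W = transpose Q ** H ** Q"
    by (simp add: W_eq H_def matrix_transpose_mul matrix_mul_assoc)
  then have f: "mat_fun ?f (cmat (transpose W ** ?A ** W)) =
      cmat (transpose Q) ** mat_fun ?f (cmat H) ** cmat Q"
    by (simp only: cmat_mult) (intro mat_fun_similar, simp_all only: QQ QQ' cmat_mat_1 flip: cmat_mult)
  have "b \<in> ?S"
  proof -
    obtain j where "j \<le> k" "t j = \<infinity>"
      using assms(12) by blast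
    then show ?thesis
      unfolding rb_space_def by (intro span_base) (force simp: rb_snapshot_def)
  qed
  then have "V *v (transpose V *v b) = b"
    by (rule orthonormal_proj[OF V])
  \<comment> \<open>Expanding \<open>b\<close> in the columns of \<open>V\<close> places
    \<open>?A\<close> between \<open>transpose V\<close> and \<open>V\<close>, which brings out
    \<open>H\<close>.\<close>
  then have "transpose W *v (?A *v b) = transpose W *v (?A *v (V *v (transpose V *v b)))"
    by simp
  also have "\<dots> = transpose Q *v (H *v (transpose V *v b))"
    by (simp add: W_eq H_def matrix_transpose_mul matrix_mul_assoc matrix_vector_mul_assoc)
  finally have rhs: "cvec (transpose W *v (?A *v b)) =
      cmat (transpose Q) *v (cmat H *v cvec (transpose V *v b))"
    by (simp only: cmat_mult_vec)
  have CQ: "cmat Q ** cmat (transpose Q) = mat 1"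
    by (simp only: QQ' cmat_mat_1 flip: cmat_mult)
  \<comment> \<open>Bracketing the products of \<open>cmat Q\<close> with its transpose lets
    \<open>CQ\<close> remove every trace of the choice of \<open>W\<close>.\<close>
  have "krylov_approx ?f ?A (?A *v b) W =
      (cmat V ** (cmat Q ** cmat (transpose Q)) ** mat_fun ?f (cmat H) ** (cmat Q ** cmat (transpose Q)))
        *v (cmat H *v cvec (transpose V *v b))"
    unfolding krylov_approx_def f rhs
    by (subst W_eq) (simp only: cmat_mult matrix_mul_assoc matrix_vector_mul_assoc)
  also have "\<dots> = cmat V *v ((mat_fun ?f (cmat H) ** cmat H) *v cvec (transpose V *v b))"
    by (simp add: CQ matrix_mul_assoc matrix_vector_mul_assoc)
  also have "\<dots> = cmat V *v (mat_fun (\<lambda>z. z powr complex_of_real (s - 1)) (cmat H) *v cvec (transpose V *v b))"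
    by (simp only: mat_fun_powr_minus_1[OF assms(5)])
  finally show ?thesis
    by (simp only: dual_rb_approx_def H_def)
qed

end
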